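(* Let $D$ be a pre-divergence on a Polish space $\mathcal{X}$, $c$ a cost function, and $\mu\in\mathcal{P}(\mathcal{X})$ such that (1) $P\mapsto D(P\|\mu)$ is lower semicontinuous and has compact sublevel sets, and (2) $D(\mu_n\|\mu)\to0$ implies $\mu_n\to\mu$ weakly. For $r>0$ let $c_r=rc$. Then for every $\nu\in\mathcal{P}(\mathcal{X})$, \[\lim_{r\to0^+}r^{-1}D^{c_r}(\nu\|\mu)=C(\mu,\nu).\]
   Context: $\mathcal{P}(\mathcal{X})$ is the set of Borel probability measures on the Polish space $\mathcal{X}$ with the weak topology. A pre-divergence is $D:\mathcal{P}(\mathcal{X})\times\mathcal{P}(\mathcal{X})\to[0,\infty]$ with $D(\mu\|\mu)=0$ for all $\mu$. A cost function is a lower semicontinuous $c:\mathcal{X}\times\mathcal{X}\to[0,\infty]$, with OT cost $C(\mu,\nu)=\inf\{\int c\,d\pi:\pi_1=\mu,\pi_2=\nu\}$. For a cost function $c'$, $D^{c'}(\nu\|\mu)=\inf_{\eta\in\mathcal{P}(\mathcal{X})}\{D(\eta\|\mu)+C'(\eta,\nu)\}$ where $C'$ is the OT cost of $c'$. *)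

theory Defs
  imports "HOL-Probability.Probability"
begin

definition prob_measures :: "('a::topological_space) measure set" where
  "prob_measures = {M. prob_space M \<and> sets M = sets borel}"

definition bcont :: "('a::topological_space \<Rightarrow> real) set" where
  "bcont = {f. continuous_on UNIV f \<and> bounded (range f)}"

definition weak_topology :: "('a::topological_space) measure topology" where
  "weak_topology = topology_generated_by
     {{P \<in> prob_measures. integral\<^sup>L P f \<in> U} | f U. f \<in> bcont \<and> open U}"

definition weak_conv_seq :: "(nat \<Rightarrow> ('a::topological_space) measure) \<Rightarrow> 'a measure \<Rightarrow> bool" where
  "weak_conv_seq Ps P \<longleftrightarrow> (\<forall>f \<in> bcont. (\<lambda>n. integral\<^sup>L (Ps n) f) \<longlonglongrightarrow> integral\<^sup>L P f)"

definition pre_divergence :: "(('a::topological_space) measure \<Rightarrow> 'a measure \<Rightarrow> ennreal) \<Rightarrow> bool" where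
  "pre_divergence D \<longleftrightarrow> (\<forall>\<mu> \<in> prob_measures. D \<mu> \<mu> = 0)"

definition cost_function :: "('a::topological_space \<Rightarrow> 'a \<Rightarrow> ennreal) \<Rightarrow> bool" where
  "cost_function c \<longleftrightarrow> (\<forall>t. closed {p. c (fst p) (snd p) \<le> t})"

definition couplings :: "('a::topological_space) measure \<Rightarrow> 'a measure \<Rightarrow> ('a \<times> 'a) measure set" where
  "couplings \<mu> \<nu> = {\<pi>. prob_space \<pi> \<and> sets \<pi> = sets (borel :: ('a \<times> 'a) measure)
      \<and> distr \<pi> borel fst = \<mu> \<and> distr \<pi> borel snd = \<nu>}"

definition OT_cost :: "('a::topological_space \<Rightarrow> 'a \<Rightarrow> ennreal) \<Rightarrow> 'a measure \<Rightarrow> 'a measure \<Rightarrow> ennreal" where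
  "OT_cost c \<mu> \<nu> = (INF \<pi> \<in> couplings \<mu> \<nu>. \<integral>\<^sup>+ p. c (fst p) (snd p) \<partial>\<pi>)"

definition D_cost :: "(('a::topological_space) measure \<Rightarrow> 'a measure \<Rightarrow> ennreal)
    \<Rightarrow> ('a \<Rightarrow> 'a \<Rightarrow> ennreal) \<Rightarrow> 'a measure \<Rightarrow> 'a measure \<Rightarrow> ennreal" where
  "D_cost D c' \<nu> \<mu> = (INF \<eta> \<in> prob_measures. D \<eta> \<mu> + OT_cost c' \<eta> \<nu>)"

end

theory Submission
  imports Defs
begin

text \<open>Taking \<open>\<eta> = \<mu>\<close> gives the upper bound for every \<open>r\<close>. If the lower bound fails along some
  \<open>r\<^sub>n \<rightarrow> 0\<close>, near-minimizers \<open>\<eta>\<^sub>n\<close> satisfy \<open>D \<eta>\<^sub>n \<mu> < r\<^sub>n K\<close> and \<open>C(\<eta>\<^sub>n, \<nu>) < K < C(\<mu>, \<nu>)\<close>;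
  then \<open>\<eta>\<^sub>n \<rightarrow> \<mu>\<close> weakly, which contradicts lower semicontinuity of the optimal transport cost.

  That semicontinuity needs a limit of couplings, here without Prokhorov's theorem. Tychonoff's theorem
  yields a filter along which the couplings \<open>\<pi>\<^sub>n\<close> converge on every set to a finitely additive
  \<open>L\<close>. The sets that \<open>L\<close> approximates from inside by closed and from outside by open sets form an
  algebra generating the Borel sets. Tightness makes \<open>L\<close> continuous at the empty set there, so
  Caratheodory's theorem extends it to a measure \<open>P\<close>, and \<open>P U \<le> L U\<close> for open \<open>U\<close>. Integrating level
  sets, this inequality passes to lower semicontinuous integrands; applied to \<open>f\<close> and \<open>1 - f\<close>
  it also identifies the marginals of \<open>P\<close>.\<close>

subsection \<open>Countably additive measures below a tight content\<close>

text \<open>The cube of all functions into [0,1] is compact, so the sequence has a cluster point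
  \<open>L\<close> there, and \<open>G\<close> is the common refinement of
  \<open>sequentially\<close> and the pullback of the neighbourhoods of \<open>L\<close>; clustering
  is exactly what makes it proper. A filter takes the place of a subsequence because the index type
  is arbitrary (below: all sets), where the cube need not be sequentially compact.\<close>

lemma pointwise_cluster_filter:
  fixes \<phi> :: "nat \<Rightarrow> 'b \<Rightarrow> real"
  assumes "\<And>n b. 0 \<le> \<phi> n b" "\<And>n b. \<phi> n b \<le> 1"
  obtains G L where "G \<noteq> bot" "G \<le> sequentially" "\<And>b. ((\<lambda>n. \<phi> n b) \<longlongrightarrow> L b) G"
proof -
  let ?S = "PiE UNIV (\<lambda>_::'b. {0..1::real})"
  have "compactin (product_topology (\<lambda>i::'b. euclidean::real topology) UNIV) ?S"
    unfolding compactin_PiE by simp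
  then have "compact ?S"
    unfolding euclidean_product_topology by simp
  moreover have "filtermap \<phi> sequentially \<noteq> bot"
    by (simp add: filtermap_bot_iff)
  moreover have "eventually (\<lambda>x. x \<in> ?S) (filtermap \<phi> sequentially)"
    using assms by (auto simp: eventually_filtermap PiE_def Pi_def)
  ultimately obtain L where L: "inf (nhds L) (filtermap \<phi> sequentially) \<noteq> bot"
    unfolding compact_filter by blast
  define G where "G = inf sequentially (filtercomap \<phi> (nhds L))"
  have "G \<noteq> bot"
  proof
    assume "G = bot"
    then obtain P Q where PQ: "eventually P sequentially" "eventually Q (nhds L)"
        "\<And>x. P x \<Longrightarrow> Q (\<phi> x) \<Longrightarrow> False"
      unfolding G_def trivial_limit_def eventually_inf eventually_filtercomap by blast
    have "eventually (\<lambda>x. \<not> Q x) (filtermap \<phi> sequentially)"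
      using PQ(1) unfolding eventually_filtermap by (rule eventually_mono) (use PQ(3) in blast)
    then have "inf (nhds L) (filtermap \<phi> sequentially) = bot"
      unfolding trivial_limit_def eventually_inf using PQ(2) by blast
    with L show False by blast
  qed
  moreover have "G \<le> sequentially"
    by (simp add: G_def)
  moreover have "((\<lambda>n. \<phi> n b) \<longlongrightarrow> L b) G" for b
  proof -
    have "filterlim \<phi> (nhds L) (filtercomap \<phi> (nhds L))"
      by (rule filterlim_filtercomap)
    then have lim: "filterlim \<phi> (nhds L) G"
      by (rule filterlim_mono) (auto simp: G_def)
    show ?thesis
    proof (rule topological_tendstoI)
      fix S :: "real set" assume S: "open S" "L b \<in> S"
      have "open ((\<lambda>f::'b \<Rightarrow> real. f b) -` S)"
        using S(1) by (rule open_vimage) (rule continuous_on_product_coordinates)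
      from topological_tendstoD[OF lim this] S(2) show "\<forall>\<^sub>F n in G. \<phi> n b \<in> S"
        by simp
    qed
  qed
  ultimately show ?thesis using that by blast
qed


text \<open>Cantor's intersection theorem for sets that are each covered at one scale only. Points
  chosen from the finite intersections form a totally bounded sequence, because all but the first
  \<open>i\<close> of them lie in \<open>K i\<close>. By completeness a subsequence converges, and
  its limit lies in every \<open>K i\<close>.\<close>

lemma totally_bounded_nested_Inter_nonempty:
  fixes K :: "nat \<Rightarrow> 'z::complete_space set"
  assumes clo: "\<And>i. closed (K i)"
    and cov: "\<And>i. \<exists>X. finite X \<and> K i \<subseteq> (\<Union>x\<in>X. cball x (1 / real (Suc i)))"
    and ne: "\<And>k. (\<Inter>i\<le>k. K i) \<noteq> {}"
  shows "(\<Inter>i. K i) \<noteq> {}"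
proof -
  obtain x where x: "\<And>k. x k \<in> (\<Inter>i\<le>k. K i)"
    using choice[of "\<lambda>k y. y \<in> (\<Inter>i\<le>k. K i)"] ne by blast
  have "compact (closure (range x))"
    unfolding compact_eq_totally_bounded
  proof (intro conjI allI impI)
    show "uniform_space_class.complete (closure (range x))" by (simp add: complete_eq_closed)
    fix e :: real assume "e > 0"
    then obtain i where i: "1 / real (Suc i) < e"
      by (metis nat_approx_posE)
    obtain X where X: "finite X" "K i \<subseteq> (\<Union>x\<in>X. cball x (1 / real (Suc i)))"
      using cov by blast
    \<comment> \<open>The finitely many terms that may lie outside \<open>K i\<close> serve as their
      own centres.\<close>
    let ?Y = "X \<union> x ` {..<i}"
    have "range x \<subseteq> (\<Union>y\<in>?Y. cball y (1 / real (Suc i)))"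
    proof safe
      fix k
      show "x k \<in> (\<Union>y\<in>?Y. cball y (1 / real (Suc i)))"
      proof (cases "k < i")
        case True
        then show ?thesis by force
      next
        case False
        then have "x k \<in> K i" using x[of k] by auto
        then have "x k \<in> (\<Union>y\<in>X. cball y (1 / real (Suc i)))" using X(2) by blast
        then show ?thesis by blast
      qed
    qed
    moreover have "closed (\<Union>y\<in>?Y. cball y (1 / real (Suc i)))"
      using X by (intro closed_UN) auto
    ultimately have "closure (range x) \<subseteq> (\<Union>y\<in>?Y. cball y (1 / real (Suc i)))"
      by (rule closure_minimal)
    also have "\<dots> \<subseteq> (\<Union>y\<in>?Y. ball y e)"
      using i by (intro UN_mono) auto
    finally show "\<exists>k. finite k \<and> closure (range x) \<subseteq> (\<Union>x\<in>k. ball x e)"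
      using X by (intro exI[of _ ?Y]) auto
  qed
  then have "seq_compact (closure (range x))"
    by (rule compact_imp_seq_compact)
  moreover have "\<forall>n. x n \<in> closure (range x)"
    using closure_subset[of "range x"] by (auto simp: subset_iff)
  ultimately obtain l r where lr: "strict_mono (r :: nat \<Rightarrow> nat)" "(x \<circ> r) \<longlonglongrightarrow> l"
    by (rule seq_compactE)
  have "l \<in> K i" for i
  proof (rule Lim_in_closed_set[OF clo _ _ lr(2)])
    show "\<forall>\<^sub>F n in sequentially. (x \<circ> r) n \<in> K i"
      unfolding eventually_sequentially
    proof (intro exI[of _ i] allI impI)
      fix n assume "i \<le> n"
      also have "n \<le> r n" using lr(1) by (rule seq_suble)
      finally show "(x \<circ> r) n \<in> K i" using x[of "r n"] by auto
    qed
  qed simp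
  then show ?thesis by blast
qed

text \<open>Tightness is stated for one radius at a time. As \<open>L\<close> is only finitely
  additive, intersecting the finite ball unions over all radii may lose mass, so a compact set of
  large content need not exist.\<close>

locale tight_content =
  fixes L :: "'z::complete_space set \<Rightarrow> real"
  assumes nonneg: "0 \<le> L E"
    and content_additive: "E \<in> sets borel \<Longrightarrow> F \<in> sets borel \<Longrightarrow> E \<inter> F = {} \<Longrightarrow> L (E \<union> F) = L E + L F"
    and total: "L UNIV = 1"
    and tight: "0 < e \<Longrightarrow> 0 < d \<Longrightarrow> \<exists>X. finite X \<and> L (- (\<Union>x\<in>X. cball x d)) \<le> e"
begin

lemma content_mono:
  assumes "E \<in> sets borel" "F \<in> sets borel" "E \<subseteq> F"
  shows "L E \<le> L F"
proof -
  have "L (E \<union> (F - E)) = L E + L (F - E)"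
    using assms by (intro content_additive) auto
  moreover have "E \<union> (F - E) = F" using assms by auto
  ultimately show ?thesis using nonneg[of "F - E"] by simp
qed

lemma content_diff:
  assumes "E \<in> sets borel" "F \<in> sets borel" "E \<subseteq> F"
  shows "L (F - E) = L F - L E"
proof -
  have "L (E \<union> (F - E)) = L E + L (F - E)"
    using assms by (intro content_additive) auto
  moreover have "E \<union> (F - E) = F" using assms by auto
  ultimately show ?thesis by simp
qed

lemma content_empty: "L {} = 0"
  using content_additive[of "{}" "{}"] by simp

lemma content_subadditive:
  assumes "E \<in> sets borel" "F \<in> sets borel"
  shows "L (E \<union> F) \<le> L E + L F"
proof -
  have "L (E \<union> (F - E)) = L E + L (F - E)"
    using assms by (intro content_additive) auto
  moreover have "E \<union> (F - E) = E \<union> F" by auto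
  moreover have "L (F - E) \<le> L F" using assms by (intro content_mono) auto
  ultimately show ?thesis by simp
qed

lemma content_finite_subadditive:
  assumes "finite I" "\<And>i. i \<in> I \<Longrightarrow> E i \<in> sets borel"
  shows "L (\<Union>i\<in>I. E i) \<le> (\<Sum>i\<in>I. L (E i))"
  using assms
proof (induction I rule: finite_induct)
  case empty
  then show ?case by (simp add: content_empty)
next
  case (insert i I)
  have "L (E i \<union> (\<Union>i\<in>I. E i)) \<le> L (E i) + L (\<Union>i\<in>I. E i)"
    using insert by (intro content_subadditive sets.finite_UN) auto
  then show ?case using insert by fastforce
qed

text \<open>On all Borel sets \<open>L\<close> can fail to be countably additive: a limit of point
  masses at 1/n gives full content to each interval (0,1/k), though these decrease to the empty set.
  Requiring a small gap between a closed and an open approximation excludes such sets.\<close>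

definition regular_sets :: "'z set set" where
  "regular_sets = {E \<in> sets borel. \<forall>e>0. \<exists>F Q. closed F \<and> open Q \<and> F \<subseteq> E \<and> E \<subseteq> Q \<and> L (Q - F) < e}"

lemma algebra_regular_sets: "algebra UNIV regular_sets"
  unfolding algebra_iff_Un
proof (intro conjI ballI)
  show "regular_sets \<subseteq> Pow UNIV" by simp
  show "{} \<in> regular_sets"
    unfolding regular_sets_def using content_empty by (auto intro!: exI[of _ "{}"])
next
  fix E assume E: "E \<in> regular_sets"
  show "UNIV - E \<in> regular_sets"
    unfolding regular_sets_def
  proof (safe)
    show "UNIV - E \<in> sets borel" using E by (auto simp: regular_sets_def)
    fix e :: real assume "e > 0"
    then obtain F Q where FQ: "closed F" "open Q" "F \<subseteq> E" "E \<subseteq> Q" "L (Q - F) < e"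
      using E unfolding regular_sets_def by blast
    have "-F - -Q = Q - F" by auto
    then show "\<exists>F Q. closed F \<and> open Q \<and> F \<subseteq> UNIV - E \<and> UNIV - E \<subseteq> Q \<and> L (Q - F) < e"
      using FQ by (intro exI[of _ "-Q"] exI[of _ "-F"]) auto
  qed
next
  fix E E' assume E: "E \<in> regular_sets" "E' \<in> regular_sets"
  show "E \<union> E' \<in> regular_sets"
    unfolding regular_sets_def
  proof (safe)
    show "E \<union> E' \<in> sets borel" using E by (auto simp: regular_sets_def)
    fix e :: real assume "e > 0"
    then have "e / 2 > 0" by simp
    then obtain F Q F' Q' where FQ: "closed F" "open Q" "F \<subseteq> E" "E \<subseteq> Q" "L (Q - F) < e / 2"
       "closed F'" "open Q'" "F' \<subseteq> E'" "E' \<subseteq> Q'" "L (Q' - F') < e / 2"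
      using E unfolding regular_sets_def by blast
    have "L ((Q \<union> Q') - (F \<union> F')) \<le> L ((Q - F) \<union> (Q' - F'))"
      using FQ by (intro content_mono) auto
    also have "\<dots> \<le> L (Q - F) + L (Q' - F')"
      using FQ by (intro content_subadditive) auto
    also have "\<dots> < e" using FQ by simp
    finally show "\<exists>F Q. closed F \<and> open Q \<and> F \<subseteq> E \<union> E' \<and> E \<union> E' \<subseteq> Q \<and> L (Q - F) < e"
      using FQ by (intro exI[of _ "F \<union> F'"] exI[of _ "Q \<union> Q'"]) auto
  qed
qed

text \<open>If the contents stayed above \<open>e\<close>, one could shrink each \<open>E i\<close>
  to a closed set \<open>K i\<close> covered by finitely many balls of radius 1/(i+1), losing less
  than \<open>e\<close> in total. Finite intersections of the \<open>K i\<close> are then nonempty,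
  so by total boundedness and completeness all of them share a point, which lies in every
  \<open>E i\<close>.\<close>

lemma continuous_at_empty:
  assumes E: "range E \<subseteq> regular_sets" "decseq E" "(\<Inter>i::nat. E i) = {}"
  shows "(\<lambda>i. L (E i)) \<longlonglongrightarrow> 0"
proof (rule ccontr)
  assume not: "\<not> (\<lambda>i. L (E i)) \<longlonglongrightarrow> 0"
  have Eb: "E i \<in> sets borel" for i using E(1) unfolding regular_sets_def by blast
  have "\<exists>e>0. \<forall>i. e \<le> L (E i)"
  proof (rule ccontr)
    assume "\<not> ?thesis"
    then have *: "\<And>e. e > 0 \<Longrightarrow> \<exists>i. L (E i) < e" by (auto simp: not_le)
    have "(\<lambda>i. L (E i)) \<longlonglongrightarrow> 0"
    proof (rule LIMSEQ_I)
      fix e :: real assume "e > 0"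
      then obtain i where i: "L (E i) < e" using * by blast
      have "norm (L (E n) - 0) < e" if "n \<ge> i" for n
      proof -
        have "L (E n) \<le> L (E i)" using that E(2) Eb by (intro content_mono) (auto simp: decseq_def)
        then show ?thesis using i nonneg[of "E n"] by simp
      qed
      then show "\<exists>no. \<forall>n\<ge>no. norm (L (E n) - 0) < e" by blast
    qed
    with not show False by blast
  qed
  then obtain e where e: "e > 0" "\<And>i. e \<le> L (E i)" by blast
  \<comment> \<open>Each index loses \<open>d i\<close> twice, once to the closed approximation and
    once to the ball cover. The sum of all these losses is at most e/2.\<close>
  define d where "d i = e * (1/2) ^ (i + 3)" for i :: nat
  have d: "d i > 0" for i using e by (simp add: d_def)
  have "\<exists>F. closed F \<and> F \<subseteq> E i \<and> L (E i - F) < d i" for i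
  proof -
    have "E i \<in> regular_sets" using E(1) by blast
    then obtain F Q where FQ: "closed F" "open Q" "F \<subseteq> E i" "E i \<subseteq> Q" "L (Q - F) < d i"
      using d[of i] unfolding regular_sets_def by blast
    moreover have "L (E i - F) \<le> L (Q - F)"
      using FQ Eb by (intro content_mono) auto
    ultimately show ?thesis by (intro exI[of _ F]) auto
  qed
  then obtain F where F: "\<And>i. closed (F i)" "\<And>i. F i \<subseteq> E i" "\<And>i. L (E i - F i) < d i"
    by metis
  have "\<exists>X. finite X \<and> L (- (\<Union>x\<in>X. cball x (1 / real (Suc i)))) \<le> d i" for i
    using d by (intro tight) auto
  then obtain X where X: "\<And>i. finite (X i)"
      "\<And>i. L (- (\<Union>x\<in>X i. cball x (1 / real (Suc i)))) \<le> d i"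
    by metis
  define B where "B i = (\<Union>x\<in>X i. cball x (1 / real (Suc i)))" for i
  have clB: "closed (B i)" for i
    unfolding B_def using X by (intro closed_UN) auto
  define K where "K i = F i \<inter> B i" for i
  have clK: "closed (K i)" for i
    unfolding K_def using F clB by (intro closed_Int) auto
  have LK: "L (E i - K i) \<le> e / 2 * (1/2) ^ Suc i" for i
  proof -
    have "L (E i - K i) \<le> L ((E i - F i) \<union> - B i)"
      unfolding K_def using F(1) clB Eb by (intro content_mono) auto
    also have "\<dots> \<le> L (E i - F i) + L (- B i)"
      using F(1) clB Eb by (intro content_subadditive) auto
    also have "\<dots> \<le> d i + d i" using F(3)[of i] X(2)[of i, folded B_def] by simp
    finally show ?thesis by (simp add: d_def power_add power3_eq_cube)
  qed
  have ne: "(\<Inter>i\<le>k. K i) \<noteq> {}" for k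
  proof
    assume "(\<Inter>i\<le>k. K i) = {}"
    \<comment> \<open>A point of \<open>E k\<close> lies in every earlier \<open>E i\<close> by
      monotonicity but misses some \<open>K i\<close>.\<close>
    then have sub: "E k \<subseteq> (\<Union>i\<le>k. E i - K i)"
      using E(2) unfolding decseq_def by blast
    have "e \<le> L (E k)" by (rule e)
    also have "\<dots> \<le> L (\<Union>i\<le>k. E i - K i)"
      using Eb clK sub by (intro content_mono sets.finite_UN) auto
    also have "\<dots> \<le> (\<Sum>i\<le>k. L (E i - K i))"
      using Eb clK by (intro content_finite_subadditive) auto
    also have "\<dots> \<le> (\<Sum>i\<le>k. e / 2 * (1/2) ^ Suc i)"
      by (intro sum_mono LK)
    also have "\<dots> = e / 2 * (\<Sum>i\<le>k. (1/2) ^ Suc i)"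
      by (simp add: sum_distrib_left)
    also have "(\<Sum>i\<le>k. (1/2::real) ^ Suc i) = 1 - (1/2) ^ Suc k"
      by (induction k) (auto simp: field_simps)
    also have "e / 2 * (1 - (1/2) ^ Suc k) \<le> e / 2 * 1"
      using e(1) by (intro mult_left_mono) auto
    also have "e / 2 * 1 < e" using e(1) by simp
    finally show False by simp
  qed
  have "(\<Inter>i. K i) \<noteq> {}"
    using X by (intro totally_bounded_nested_Inter_nonempty clK ne) (auto simp: K_def B_def)
  then obtain y where "\<And>i. y \<in> K i" by auto
  then have "\<And>i. y \<in> E i" using F(2) unfolding K_def by blast
  then show False using E(3) by auto
qed

text \<open>The superlevel set is open, so only a closed set inside it is wanted: take the closed
  superlevel set at some \<open>s\<close> slightly above \<open>t\<close>. The gap has content at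
  most the drop of the level function from \<open>t\<close> to \<open>s\<close>, which continuity at
  \<open>t\<close> makes small. The minus sign turns this decreasing function into an increasing
  one, as the theorem on discontinuities of monotone functions expects.\<close>

lemma superlevel_regular:
  fixes f :: "'z \<Rightarrow> real"
  assumes f: "continuous_on UNIV f" and t: "isCont (\<lambda>t. - L {x. t < f x}) t"
  shows "{x. t < f x} \<in> regular_sets"
  unfolding regular_sets_def
proof (safe)
  have op: "open {x. s < f x}" for s
    using f by (intro open_Collect_less) auto
  then show "{x. t < f x} \<in> sets borel" by simp
  fix e :: real assume "e > 0"
  then obtain d where d: "d > 0" "\<And>s. dist s t < d \<Longrightarrow> dist (- L {x. s < f x}) (- L {x. t < f x}) < e"
    using t unfolding continuous_at_eps_delta by blast
  define s where "s = t + d / 2"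
  have s: "s > t" "dist s t < d" using d by (auto simp: s_def dist_real_def)
  have cl: "closed {x. s \<le> f x}"
    using f by (intro closed_Collect_le) auto
  have "L ({x. t < f x} - {x. s \<le> f x}) \<le> L ({x. t < f x} - {x. s < f x})"
    using op cl by (intro content_mono) auto
  also have "\<dots> = L {x. t < f x} - L {x. s < f x}"
    using op s by (intro content_diff) auto
  also have "\<dots> < e" using d(2)[OF s(2)] by (simp add: dist_real_def)
  finally show "\<exists>F Q. closed F \<and> open Q \<and> F \<subseteq> {x. t < f x} \<and> {x. t < f x} \<subseteq> Q \<and> L (Q - F) < e"
    using op cl s by (intro exI[of _ "{x. s \<le> f x}"] exI[of _ "{x. t < f x}"]) auto
qed

text \<open>The monotone function \<open>t \<mapsto> L {x. t < f x}\<close> has at most countably many discontinuities, so arbitrarily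
  small admissible levels of \<open>f = infdist _ (- U)\<close> exist.\<close>
lemma open_eq_UN_regular:
  assumes "open U"
  obtains V :: "nat \<Rightarrow> 'z set" where "range V \<subseteq> regular_sets" "U = (\<Union>k. V k)"
\<comment> \<open>By convention \<open>infdist\<close> to the empty set is 0, so the distance to the
  complement is useless when \<open>U\<close> is the whole space.\<close>
proof (cases "U = UNIV")
  case True
  interpret algebra UNIV regular_sets by (rule algebra_regular_sets)
  show ?thesis using True top by (intro that[of "\<lambda>_. UNIV"]) auto
next
  case False
  define f where "f x = infdist x (- U)" for x
  have f: "continuous_on UNIV f" unfolding f_def by (intro continuous_intros)
  have op: "open {x. s < f x}" for s
    using f by (intro open_Collect_less) auto
  have "mono (\<lambda>t. - L {x. t < f x})"
    using op by (intro monoI) (auto intro!: content_mono)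
  then have ctb: "countable {t. \<not> isCont (\<lambda>t. - L {x. t < f x}) t}"
    by (rule mono_ctble_discont)
  have "\<exists>t\<in>{0<..<1 / real (Suc k)}. t \<notin> {t. \<not> isCont (\<lambda>t. - L {x. t < f x}) t}" for k
    using real_interval_avoid_countable_set[OF _ ctb, of 0 "1 / real (Suc k)"] by auto
  then obtain t where t: "\<And>k. t k \<in> {0<..<1 / real (Suc k)}"
      "\<And>k. isCont (\<lambda>t. - L {x. t < f x}) (t k)"
    by (metis mem_Collect_eq)
  have "U = (\<Union>k. {x. t k < f x})"
  proof (intro subset_antisym subsetI)
    fix x assume "x \<in> U"
    then have "f x > 0"
      using False assms unfolding f_def by (intro infdist_pos_not_in_closed) auto
    then obtain k where "1 / real (Suc k) < f x"
      by (metis nat_approx_posE)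
    then have "t k < f x" using t(1)[of k] by simp
    then show "x \<in> (\<Union>k. {x. t k < f x})" by auto
  next
    fix x assume "x \<in> (\<Union>k. {x. t k < f x})"
    then obtain k where "t k < f x" by auto
    then have "0 < f x" using t(1)[of k] by simp
    then show "x \<in> U" unfolding f_def by (metis ComplI infdist_zero less_irrefl)
  qed
  moreover have "range (\<lambda>k. {x. t k < f x}) \<subseteq> regular_sets"
    using superlevel_regular[OF f t(2)] by auto
  ultimately show ?thesis using that by blast
qed

lemma sigma_regular_sets: "sigma_sets UNIV regular_sets = sets borel"
proof
  have "sigma_sets UNIV regular_sets \<subseteq> sigma_sets (space borel) (sets borel)"
    unfolding space_borel by (intro sigma_sets_mono') (auto simp: regular_sets_def)
  then show "sigma_sets UNIV regular_sets \<subseteq> sets borel"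
    by (simp only: sets.sigma_sets_eq)
  have "U \<in> sigma_sets UNIV regular_sets" if U: "open U" for U
  proof -
    obtain V where V: "range V \<subseteq> regular_sets" "U = (\<Union>k::nat. V k)"
      using open_eq_UN_regular[OF U] .
    show ?thesis unfolding V(2)
      using V(1) by (intro sigma_sets.Union sigma_sets.Basic) auto
  qed
  then show "sets borel \<subseteq> sigma_sets UNIV regular_sets"
    unfolding borel_def by (subst sets_measure_of) (auto intro!: sigma_sets_mono)
qed

text \<open>On regular sets the Caratheodory extension agrees with \<open>L\<close>. An open set is
  a countable union of regular sets, so its measure is a supremum of contents of regular subsets.
  Equality may fail on open sets, since \<open>L\<close> can keep mass near the boundary that no
  such subset captures.\<close>

theorem dominated_measure_exists:
  obtains P where "prob_space P" "sets P = sets borel"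
    "\<And>U. open U \<Longrightarrow> measure P U \<le> L U"
proof -
  interpret algebra UNIV regular_sets by (rule algebra_regular_sets)
  have "\<exists>m :: 'z set \<Rightarrow> ennreal. (\<forall>s \<in> regular_sets. m s = ennreal (L s)) \<and>
      measure_space UNIV (sigma_sets UNIV regular_sets) m"
  proof (rule caratheodory_empty_continuous)
    show "positive regular_sets (\<lambda>s. ennreal (L s))"
      by (simp add: positive_def content_empty)
    show "additive regular_sets (\<lambda>s. ennreal (L s))"
      unfolding additive_def
      using nonneg by (auto simp: content_additive regular_sets_def)
    show "(\<lambda>i. ennreal (L (A i))) \<longlonglongrightarrow> 0"
      if "range A \<subseteq> regular_sets" "decseq A" "(\<Inter>i. A i) = {}" for A :: "nat \<Rightarrow> 'z set"
      using continuous_at_empty[OF that] by (metis ennreal_0 tendsto_ennrealI)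
  qed simp
  then obtain m :: "'z set \<Rightarrow> ennreal" where m: "\<And>s. s \<in> regular_sets \<Longrightarrow> m s = ennreal (L s)"
      "measure_space UNIV (sets borel) m"
    unfolding sigma_regular_sets by blast
  define P where "P = measure_of UNIV (sets borel) m"
  have sets: "sets P = sets borel"
    unfolding P_def using sets.sigma_sets_eq[of "borel :: 'z measure"] by simp
  have space: "space P = UNIV" unfolding P_def by simp
  have em: "emeasure P E = m E" if "E \<in> sets borel" for E
    unfolding P_def using m(2) that
    by (intro emeasure_measure_of_sigma) (auto simp: measure_space_def)
  have reg: "emeasure P E = ennreal (L E)" if "E \<in> regular_sets" for E
    using that em m(1) by (auto simp: regular_sets_def)
  interpret P: prob_space P
    using reg[OF top] total space by (intro prob_spaceI) auto
  have "measure P U \<le> L U" if U: "open U" for U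
  proof -
    obtain V where V: "range V \<subseteq> regular_sets" "U = (\<Union>k::nat. V k)"
      using open_eq_UN_regular[OF U] .
    \<comment> \<open>Finite unions remain in the algebra and make the exhaustion increasing, as
      continuity from below requires.\<close>
    define W where "W n = (\<Union>k\<le>n. V k)" for n
    have W: "W n \<in> regular_sets" for n
      unfolding W_def using V(1) by (intro finite_UN) auto
    have UW: "U = (\<Union>n. W n)" unfolding V(2) W_def by blast
    have Wb: "W n \<in> sets borel" for n using W[of n] by (simp add: regular_sets_def)
    have "(SUP n. emeasure P (W n)) = emeasure P (\<Union>n. W n)"
      using Wb sets by (intro SUP_emeasure_incseq) (auto simp: incseq_def W_def intro: order_trans)
    moreover have "emeasure P (W n) \<le> ennreal (L U)" for n
      unfolding reg[OF W] using Wb U UW by (intro ennreal_leI content_mono) auto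
    ultimately have "emeasure P U \<le> ennreal (L U)"
      unfolding UW by (metis SUP_least UW)
    then show ?thesis
      using nonneg[of U] by (simp add: P.emeasure_eq_measure)
  qed
  then show ?thesis using that P.prob_space_axioms sets by blast
qed

end

subsection \<open>Lower semicontinuous integrands\<close>

text \<open>A discrete layer-cake sum. With strict thresholds, the level sets of a lower
  semicontinuous function are open, so its staircase integrates to a finite combination of measures
  of open sets, the sets on which \<open>P\<close> is compared with \<open>L\<close>.\<close>

definition staircase :: "real \<Rightarrow> nat \<Rightarrow> ennreal \<Rightarrow> ennreal" where
  "staircase h N v = (\<Sum>j<N. if ennreal (real (Suc j) * h) < v then ennreal h else 0)"

lemma staircase_le_width:
  assumes "0 \<le> h"
  shows "staircase h N v \<le> ennreal (real N * h)"
proof -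
  have "staircase h N v \<le> (\<Sum>j<N. ennreal h)"
    unfolding staircase_def by (intro sum_mono) auto
  then show ?thesis using assms by (simp add: ennreal_mult ennreal_of_nat_eq_real_of_nat)
qed

lemma staircase_le:
  assumes "0 \<le> h"
  shows "staircase h N v \<le> v"
proof (induction N)
  case 0
  then show ?case by (simp add: staircase_def)
next
  case (Suc N)
  show ?case
  proof (cases "ennreal (real (Suc N) * h) < v")
    case True
    have "staircase h (Suc N) v \<le> ennreal (real (Suc N) * h)"
      using assms by (rule staircase_le_width)
    with True show ?thesis by simp
  next
    case False
    then have "staircase h (Suc N) v = staircase h N v" by (simp add: staircase_def)
    with Suc show ?thesis by simp
  qed
qed

lemma staircase_ge:
  assumes "0 \<le> h" "k \<le> N" "ennreal (real k * h) < v"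
  shows "ennreal (real k * h) \<le> staircase h N v"
proof -
  have "ennreal (real k * h) = (\<Sum>j<k. ennreal h)"
    using assms by (simp add: ennreal_mult ennreal_of_nat_eq_real_of_nat)
  also have "\<dots> = (\<Sum>j<k. if ennreal (real (Suc j) * h) < v then ennreal h else 0)"
  proof (intro sum.cong refl)
    fix j assume "j \<in> {..<k}"
    then have "real (Suc j) * h \<le> real k * h" using assms by (intro mult_right_mono) auto
    then have "ennreal (real (Suc j) * h) < v"
      using assms(3) by (meson ennreal_leI le_less_trans)
    then show "ennreal h = (if ennreal (real (Suc j) * h) < v then ennreal h else 0)" by simp
  qed
  also have "\<dots> \<le> staircase h N v"
    unfolding staircase_def using assms by (intro sum_mono2) auto
  finally show ?thesis .
qed

text \<open>Let y < z < v. Once the mesh is finer than z - y and the cap \<open>m\<close> is at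
  least \<open>z\<close>, the largest mesh point not above \<open>z\<close> still exceeds
  \<open>y\<close>, and the staircase reaches it. The liminf form is the one that Fatou's lemma
  consumes.\<close>

lemma le_liminf_staircase: "v \<le> liminf (\<lambda>m. staircase (1 / 2 ^ m) (m * 2 ^ m) v)"
  unfolding le_Liminf_iff
proof (intro allI impI)
  fix y assume "y < v"
  then obtain z' where z': "y < z'" "z' < v" using dense by blast
  obtain z where z: "z' = ennreal z" "0 \<le> z"
    using z'(2) by (cases z') auto
  obtain y' where y': "y = ennreal y'" "0 \<le> y'"
    using z'(1) by (cases y) auto
  have yz: "y' < z" using z'(1) z y' by (simp add: ennreal_less_iff)
  obtain m1 where m1: "(1/2) ^ m1 < z - y'"
    using real_arch_pow_inv[of "z - y'" "1/2"] yz by auto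
  show "\<forall>\<^sub>F m in sequentially. y < staircase (1 / 2 ^ m) (m * 2 ^ m) v"
    unfolding eventually_sequentially
  proof (intro exI[of _ "max m1 (nat \<lceil>z\<rceil>)"] allI impI)
    fix m assume m: "max m1 (nat \<lceil>z\<rceil>) \<le> m"
    have "(1/2::real) ^ m \<le> (1/2) ^ m1"
      using m by (intro power_decreasing) auto
    then have h: "1 / 2 ^ m < z - y'" using m1 by (simp add: power_one_over)
    define k where "k = nat \<lfloor>z * 2 ^ m\<rfloor>"
    have k: "real k \<le> z * 2 ^ m" "z * 2 ^ m < real k + 1"
      using z(2) unfolding k_def by auto
    have "z \<le> real m" using m by linarith
    then have "real k \<le> real m * 2 ^ m"
      using k(1) by (meson mult_right_mono order_trans zero_le_numeral zero_le_power)
    then have kN: "k \<le> m * 2 ^ m"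
      by (metis of_nat_le_iff of_nat_mult of_nat_numeral of_nat_power)
    have "real k * (1 / 2 ^ m) \<le> z" using k(1) by (simp add: field_simps)
    then have "ennreal (real k * (1 / 2 ^ m)) < v"
      using z'(2) z(1) by (metis ennreal_leI le_less_trans)
    then have *: "ennreal (real k * (1 / 2 ^ m)) \<le> staircase (1 / 2 ^ m) (m * 2 ^ m) v"
      using kN by (intro staircase_ge) auto
    have "z < real k * (1 / 2 ^ m) + 1 / 2 ^ m" using k(2) by (simp add: field_simps)
    then have "y' < real k * (1 / 2 ^ m)" using h by simp
    then have "y < ennreal (real k * (1 / 2 ^ m))" using y' by (simp add: ennreal_less_iff)
    then show "y < staircase (1 / 2 ^ m) (m * 2 ^ m) v" using * by (rule less_le_trans)
  qed
qed

lemma nn_integral_staircase: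
  fixes g :: "'z::topological_space \<Rightarrow> ennreal"
  assumes "prob_space Q" "sets Q = sets borel" "\<And>t. closed {x. g x \<le> t}" "0 \<le> h"
  shows "(\<integral>\<^sup>+x. staircase h N (g x) \<partial>Q) = ennreal (\<Sum>j<N. h * measure Q {x. ennreal (real (Suc j) * h) < g x})"
proof -
  interpret Q: prob_space Q by fact
  have op: "open {x. t < g x}" for t
    using assms(3)[of t] by (simp add: closed_def Collect_neg_eq[symmetric] not_le)
  have ms: "{x. t < g x} \<in> sets Q" for t using op assms(2) by simp
  have "(\<integral>\<^sup>+x. staircase h N (g x) \<partial>Q)
      = (\<integral>\<^sup>+x. (\<Sum>j<N. ennreal h * indicator {x. ennreal (real (Suc j) * h) < g x} x) \<partial>Q)"
    unfolding staircase_def by (intro nn_integral_cong sum.cong refl) (auto simp: indicator_def)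
  also have "\<dots> = (\<Sum>j<N. ennreal h * emeasure Q {x. ennreal (real (Suc j) * h) < g x})"
    using ms by (subst nn_integral_sum) (auto simp: nn_integral_cmult_indicator)
  also have "\<dots> = (\<Sum>j<N. ennreal (h * measure Q {x. ennreal (real (Suc j) * h) < g x}))"
    using assms(4) by (simp add: Q.emeasure_eq_measure ennreal_mult)
  also have "\<dots> = ennreal (\<Sum>j<N. h * measure Q {x. ennreal (real (Suc j) * h) < g x})"
    using assms(4) by (intro sum_ennreal) auto
  finally show ?thesis .
qed

text \<open>Truncated multiples of the distance to the complement converge to the indicator of an
  open set, so dominated convergence gives agreement on open sets, a generating family closed under
  intersection. Test functions are limited to values in [0,1] to match \<open>integral_eq\<close>
  below.\<close>

lemma prob_measure_eqI_continuous:
  fixes P Q :: "'a::metric_space measure"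
  assumes P: "prob_space P" "sets P = sets borel" and Q: "prob_space Q" "sets Q = sets borel"
    and eq: "\<And>f :: 'a \<Rightarrow> real. continuous_on UNIV f \<Longrightarrow> (\<And>x. 0 \<le> f x) \<Longrightarrow> (\<And>x. f x \<le> 1)
      \<Longrightarrow> integral\<^sup>L P f = integral\<^sup>L Q f"
  shows "P = Q"
proof -
  interpret P: prob_space P by fact
  interpret Q: prob_space Q by fact
  have "measure P U = measure Q U" if U: "open U" for U
  \<comment> \<open>Again the distance to an empty complement would be 0 by convention.\<close>
  proof (cases "U = UNIV")
    case True
    then show ?thesis
      using P.prob_space Q.prob_space sets_eq_imp_space_eq[OF P(2)] sets_eq_imp_space_eq[OF Q(2)] by simp
  next
    case False
    define f where "f k x = min 1 (real k * infdist x (- U))" for k x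
    have cont: "continuous_on UNIV (f k)" for k
      unfolding f_def by (intro continuous_intros)
    have lim: "(\<lambda>k. f k x) \<longlonglongrightarrow> indicat_real U x" for x
    proof (cases "x \<in> U")
      case True
      have "0 < infdist x (- U)"
        using U True False by (intro infdist_pos_not_in_closed) auto
      then obtain k0 where k0: "1 < real k0 * infdist x (- U)"
        using reals_Archimedean3 by blast
      have "\<forall>\<^sub>F k in sequentially. f k x = indicat_real U x"
        unfolding eventually_sequentially
      proof (intro exI[of _ k0] allI impI)
        fix k assume "k0 \<le> k"
        then have "real k0 * infdist x (- U) \<le> real k * infdist x (- U)"
          by (intro mult_right_mono) (auto simp: infdist_nonneg)
        then show "f k x = indicat_real U x" using k0 True by (simp add: f_def)
      qed
      then show ?thesis by (rule tendsto_eventually)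
    next
      case False
      then show ?thesis by (simp add: f_def)
    qed
    have int: "(\<lambda>k. integral\<^sup>L R (f k)) \<longlonglongrightarrow> measure R U"
      if "prob_space R" "sets R = sets borel" for R
    proof -
      interpret R: prob_space R by fact
      have "(\<lambda>k. integral\<^sup>L R (f k)) \<longlonglongrightarrow> integral\<^sup>L R (indicat_real U)"
      proof (rule integral_dominated_convergence[where w = "\<lambda>_. 1"])
        show "f k \<in> borel_measurable R" for k
          using borel_measurable_continuous_onI[OF cont] that(2) by (simp cong: measurable_cong_sets)
        show "indicat_real U \<in> borel_measurable R"
          using U that(2) by (intro borel_measurable_indicator) auto
        show "AE x in R. norm (f k x) \<le> 1" for k
          by (intro always_eventually allI) (simp add: f_def infdist_nonneg)
      qed (use lim in auto)
      moreover have "U \<inter> space R = U" using sets_eq_imp_space_eq[OF that(2)] by simp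
      ultimately show ?thesis by simp
    qed
    have "integral\<^sup>L P (f k) = integral\<^sup>L Q (f k)" for k
      using cont by (intro eq) (auto simp: f_def infdist_nonneg)
    then show ?thesis
      using int[OF P] int[OF Q] by (metis (no_types, lifting) LIMSEQ_unique ext)
  qed
  then have em: "emeasure P U = emeasure Q U" if "open U" for U
    using that by (simp add: P.emeasure_eq_measure Q.emeasure_eq_measure)
  show ?thesis
  proof (rule measure_eqI_generator_eq[where \<Omega> = UNIV and E = "{U. open U}" and A = "\<lambda>_. UNIV"])
    show "sets P = sigma_sets UNIV {U. open U}" "sets Q = sigma_sets UNIV {U. open U}"
      unfolding P Q borel_def by (simp_all add: sets_measure_of)
  qed (auto simp: em Int_stable_def)
qed

text \<open>The last two assumptions together are the open-set half of the portmanteau theorem along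
  \<open>G\<close>: the mass of an open set under \<open>P\<close> is at most the limit of its
  masses under \<open>M n\<close>.\<close>

locale open_dominated_cluster =
  fixes M :: "nat \<Rightarrow> 'z::topological_space measure" and P :: "'z measure"
    and L :: "'z set \<Rightarrow> real" and G :: "nat filter"
  assumes prob_M: "\<And>n. prob_space (M n)" and sets_M: "\<And>n. sets (M n) = sets borel"
    and prob_P: "prob_space P" and sets_P: "sets P = sets borel"
    and nontrivial: "G \<noteq> bot"
    and lim: "\<And>E. ((\<lambda>n. measure (M n) E) \<longlongrightarrow> L E) G"
    and open_le: "\<And>U. open U \<Longrightarrow> measure P U \<le> L U"
begin

text \<open>A fixed staircase reduces the claim to finitely many open sets, where \<open>P\<close>
  is below \<open>L\<close> and \<open>L\<close> is the limit of the \<open>M n\<close>; so its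
  integral is at most \<open>K\<close>. Fatou's lemma then passes from staircases to
  \<open>g\<close>, which may take the value infinity.\<close>

lemma nn_integral_le:
  assumes g: "\<And>t. closed {x. g x \<le> t}"
    and K: "\<forall>\<^sub>F n in G. (\<integral>\<^sup>+x. g x \<partial>M n) \<le> K"
  shows "(\<integral>\<^sup>+x. g x \<partial>P) \<le> K"
proof -
  have op: "open {x. t < g x}" for t
    using g[of t] by (simp add: closed_def Collect_neg_eq[symmetric] not_le)
  have stair: "(\<integral>\<^sup>+x. staircase h N (g x) \<partial>P) \<le> K" if h: "0 \<le> h" for h N
  proof -
    let ?U = "\<lambda>j. {x. ennreal (real (Suc j) * h) < g x}"
    have "(\<integral>\<^sup>+x. staircase h N (g x) \<partial>P) = ennreal (\<Sum>j<N. h * measure P (?U j))"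
      using prob_P sets_P g h by (rule nn_integral_staircase)
    also have "\<dots> \<le> ennreal (\<Sum>j<N. h * L (?U j))"
      using h op by (intro ennreal_leI sum_mono mult_left_mono open_le) auto
    also have "\<dots> \<le> K"
    proof (rule tendsto_upperbound[OF _ _ nontrivial])
      show "((\<lambda>n. ennreal (\<Sum>j<N. h * measure (M n) (?U j))) \<longlongrightarrow> ennreal (\<Sum>j<N. h * L (?U j))) G"
        by (intro tendsto_ennrealI tendsto_intros lim)
      show "\<forall>\<^sub>F n in G. ennreal (\<Sum>j<N. h * measure (M n) (?U j)) \<le> K"
        using K
      proof eventually_elim
        case (elim n)
        have "ennreal (\<Sum>j<N. h * measure (M n) (?U j)) = (\<integral>\<^sup>+x. staircase h N (g x) \<partial>M n)"
          using prob_M sets_M g h by (rule nn_integral_staircase[symmetric])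
        also have "\<dots> \<le> (\<integral>\<^sup>+x. g x \<partial>M n)"
          using h by (intro nn_integral_mono staircase_le)
        finally show ?case using elim by simp
      qed
    qed
    finally show ?thesis .
  qed
  have "{x. t < g x} \<in> sets P" for t using op sets_P by simp
  then have [measurable]: "g \<in> borel_measurable P"
    using sets_eq_imp_space_eq[OF sets_P] by (intro borel_measurableI_greater) auto
  have meas: "(\<lambda>x. staircase h N (g x)) \<in> borel_measurable P" for h N
    unfolding staircase_def by measurable
  have "(\<integral>\<^sup>+x. g x \<partial>P) \<le> (\<integral>\<^sup>+x. liminf (\<lambda>m. staircase (1 / 2 ^ m) (m * 2 ^ m) (g x)) \<partial>P)"
    by (intro nn_integral_mono le_liminf_staircase)
  also have "\<dots> \<le> liminf (\<lambda>m. \<integral>\<^sup>+x. staircase (1 / 2 ^ m) (m * 2 ^ m) (g x) \<partial>P)"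
    by (intro nn_integral_liminf meas)
  also have "\<dots> \<le> limsup (\<lambda>m. \<integral>\<^sup>+x. staircase (1 / 2 ^ m) (m * 2 ^ m) (g x) \<partial>P)"
    by (intro Liminf_le_Limsup) simp
  also have "\<dots> \<le> K"
    by (intro Limsup_bounded always_eventually allI stair) simp
  finally show ?thesis .
qed

lemma integral_le:
  fixes f :: "'z \<Rightarrow> real"
  assumes f: "continuous_on UNIV f" "\<And>x. 0 \<le> f x" "\<And>x. f x \<le> 1"
    and l: "((\<lambda>n. integral\<^sup>L (M n) f) \<longlongrightarrow> l) G"
  shows "integral\<^sup>L P f \<le> l"
\<comment> \<open>Convergence to \<open>l\<close> gives an eventual bound, as
  \<open>nn_integral_le\<close> requires, only after adding some slack \<open>e\<close>.\<close>
proof (rule field_le_epsilon)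
  fix e :: real assume e: "0 < e"
  have nn: "(\<integral>\<^sup>+x. ennreal (f x) \<partial>Q) = ennreal (integral\<^sup>L Q f)"
    if "prob_space Q" "sets Q = sets borel" for Q
  proof -
    interpret prob_space Q by fact
    have "f \<in> borel_measurable Q"
      using borel_measurable_continuous_onI[OF f(1)] that(2) by (simp cong: measurable_cong_sets)
    then show ?thesis
      using f by (intro nn_integral_eq_integral integrable_const_bound[of _ 1]) auto
  qed
  have l0: "0 \<le> l"
    using f(2) by (intro tendsto_lowerbound[OF l _ nontrivial] always_eventually) (auto intro: integral_nonneg)
  have "(\<integral>\<^sup>+x. ennreal (f x) \<partial>P) \<le> ennreal (l + e)"
  proof (rule nn_integral_le)
    show "closed {x. ennreal (f x) \<le> t}" for t
      by (cases t) (auto simp: f(2) ennreal_le_iff intro!: closed_Collect_le f(1))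
    have "\<forall>\<^sub>F n in G. integral\<^sup>L (M n) f < l + e"
      using l e by (intro order_tendstoD) auto
    then show "\<forall>\<^sub>F n in G. (\<integral>\<^sup>+x. ennreal (f x) \<partial>M n) \<le> ennreal (l + e)"
      by eventually_elim (simp add: nn prob_M sets_M ennreal_leI)
  qed
  then show "integral\<^sup>L P f \<le> l + e"
    using nn[OF prob_P sets_P] l0 e by (simp add: ennreal_le_iff del: ennreal_plus)
qed

lemma integral_eq:
  fixes f :: "'z \<Rightarrow> real"
  assumes f: "continuous_on UNIV f" "\<And>x. 0 \<le> f x" "\<And>x. f x \<le> 1"
    and l: "((\<lambda>n. integral\<^sup>L (M n) f) \<longlongrightarrow> l) G"
  shows "integral\<^sup>L P f = l"
proof (rule antisym)
  show "integral\<^sup>L P f \<le> l" using assms by (rule integral_le)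
  have compl: "(\<integral>x. 1 - f x \<partial>Q) = 1 - integral\<^sup>L Q f"
    if "prob_space Q" "sets Q = sets borel" for Q
  proof -
    interpret prob_space Q by fact
    have "f \<in> borel_measurable Q"
      using borel_measurable_continuous_onI[OF f(1)] that(2) by (simp cong: measurable_cong_sets)
    then have "integrable Q f"
      using f by (intro integrable_const_bound[of _ 1]) auto
    then show ?thesis by (simp add: prob_space)
  qed
  \<comment> \<open>Since all masses are 1, the upper bound for 1 - f is the lower bound for
    \<open>f\<close>.\<close>
  have "(\<integral>x. 1 - f x \<partial>P) \<le> 1 - l"
  proof (rule integral_le)
    show "((\<lambda>n. \<integral>x. 1 - f x \<partial>M n) \<longlongrightarrow> 1 - l) G"
      using l by (simp add: compl prob_M sets_M tendsto_diff)
  qed (use f in \<open>auto intro!: continuous_intros\<close>)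
  then show "l \<le> integral\<^sup>L P f"
    using compl[OF prob_P sets_P] by simp
qed

text \<open>Open sets only give \<open>P U \<le> L U\<close>, the wrong direction for marginals; continuous integrands give equality.\<close>
lemma distr_eq_weak_limit:
  fixes p :: "'z \<Rightarrow> 'a::metric_space"
  assumes p: "continuous_on UNIV p"
    and conv: "weak_conv_seq (\<lambda>n. distr (M n) borel p) \<mu>" "G \<le> sequentially" and \<mu>: "\<mu> \<in> prob_measures"
  shows "distr P borel p = \<mu>"
proof -
  have mp: "p \<in> measurable Q borel" if "sets Q = sets borel" for Q :: "'z measure"
    using borel_measurable_continuous_onI[OF p] that by (simp cong: measurable_cong_sets)
  show ?thesis
  proof (rule prob_measure_eqI_continuous)
    show "prob_space (distr P borel p)"
      using prob_P mp[OF sets_P] by (rule prob_space.prob_space_distr)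
    fix f :: "'a \<Rightarrow> real"
    assume f: "continuous_on UNIV f" "\<And>x. 0 \<le> f x" "\<And>x. f x \<le> 1"
    have int: "integral\<^sup>L (distr Q borel p) f = (\<integral>x. f (p x) \<partial>Q)" if "sets Q = sets borel" for Q
      using mp[OF that] borel_measurable_continuous_onI[OF f(1)] by (rule integral_distr)
    have "f \<in> bcont"
      using f unfolding bcont_def bounded_iff by (auto intro!: exI[of _ 1])
    then have "(\<lambda>n. integral\<^sup>L (distr (M n) borel p) f) \<longlonglongrightarrow> integral\<^sup>L \<mu> f"
      using conv(1) by (simp add: weak_conv_seq_def)
    then have "((\<lambda>n. \<integral>x. f (p x) \<partial>M n) \<longlongrightarrow> integral\<^sup>L \<mu> f) G"
      using conv(2) by (simp add: int sets_M tendsto_mono)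
    moreover have "continuous_on UNIV (\<lambda>x. f (p x))"
      using f(1) p by (rule continuous_on_compose2) auto
    ultimately have "(\<integral>x. f (p x) \<partial>P) = integral\<^sup>L \<mu> f"
      using f by (intro integral_eq) auto
    then show "integral\<^sup>L (distr P borel p) f = integral\<^sup>L \<mu> f"
      by (simp add: int sets_P)
  qed (use \<mu> in \<open>auto simp: prob_measures_def\<close>)
qed

end

section \<open>Tightness of weakly convergent sequences\<close>

text \<open>Separability gives finitely many balls of radius d/2 that carry almost all of \<mu>. A
  continuous function squeezed between the indicators of these balls and of the closed balls of
  radius \<open>d\<close> transfers this mass to \<open>N n\<close> for large
  \<open>n\<close>.\<close>

lemma weak_conv_seq_tight:
  fixes \<mu> :: "'a::{metric_space, second_countable_topology} measure"
  assumes conv: "weak_conv_seq N \<mu>" and N: "\<And>n. N n \<in> prob_measures" and \<mu>: "\<mu> \<in> prob_measures"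
    and e: "0 < e" and d: "0 < d"
  shows "\<exists>X. finite X \<and> (\<forall>\<^sub>F n in sequentially. measure (N n) (- (\<Union>x\<in>X. cball x d)) \<le> e)"
proof -
  interpret \<mu>: prob_space \<mu> using \<mu> by (simp add: prob_measures_def)
  have sets: "sets \<mu> = sets borel" using \<mu> by (simp add: prob_measures_def)
  obtain D :: "'a set" where D: "countable D" "\<And>U. open U \<Longrightarrow> U \<noteq> {} \<Longrightarrow> \<exists>x\<in>D. x \<in> U"
    using countable_dense_exists by blast
  have "D \<noteq> {}" using D(2)[of UNIV] by auto
  define q where "q = from_nat_into D"
  have q: "\<exists>i. x \<in> ball (q i) (d / 2)" for x
  proof -
    obtain y where "y \<in> D" "y \<in> ball x (d / 2)" using D(2)[of "ball x (d / 2)"] d by auto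
    then show ?thesis
      using from_nat_into_surj[OF D(1), of y] unfolding q_def by (auto simp: dist_commute)
  qed
  define A where "A k = (\<Union>i<k. ball (q i) (d / 2))" for k :: nat
  have "(\<lambda>k. measure \<mu> (A k)) \<longlonglongrightarrow> measure \<mu> (\<Union>k. A k)"
  proof (rule \<mu>.finite_Lim_measure_incseq)
    show "range A \<subseteq> sets \<mu>" by (auto simp: sets A_def)
    show "incseq A" unfolding incseq_def A_def by (intro allI impI UN_mono) auto
  qed
  moreover have "(\<Union>k. A k) = UNIV"
    unfolding A_def using q by blast
  moreover have "measure \<mu> UNIV = 1"
    using \<mu>.prob_space sets_eq_imp_space_eq[OF sets] by simp
  ultimately have "(\<lambda>k. measure \<mu> (A k)) \<longlonglongrightarrow> 1" by simp
  then have "\<forall>\<^sub>F k in sequentially. 1 - e / 2 < measure \<mu> (A k)"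
    using e by (intro order_tendstoD) auto
  then obtain k where k: "1 - e / 2 < measure \<mu> (A k)"
    by (auto simp: eventually_sequentially)
  \<comment> \<open>Each summand is at least 1 on the ball of radius d/2 and vanishes outside radius
    \<open>d\<close>, so \<open>f\<close> lies between the indicators of \<open>A k\<close> and
    \<open>C\<close>.\<close>
  define f where "f x = min 1 (\<Sum>i<k. max 0 (2 - 2 * dist x (q i) / d))" for x
  have cont: "continuous_on UNIV f"
    unfolding f_def using d by (intro continuous_intros) auto
  have f0: "0 \<le> f x" and f1: "f x \<le> 1" for x
    unfolding f_def by (auto intro!: sum_nonneg)
  have "f \<in> bcont"
    using cont f0 f1 unfolding bcont_def bounded_iff by (auto intro!: exI[of _ 1])
  have fA: "indicat_real (A k) x \<le> f x" for x
  proof (cases "x \<in> A k")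
    case True
    then obtain i where i: "i < k" "dist (q i) x < d / 2" by (auto simp: A_def)
    then have "1 \<le> max 0 (2 - 2 * dist x (q i) / d)"
      using d by (simp add: field_simps dist_commute max_def)
    also have "\<dots> \<le> (\<Sum>i<k. max 0 (2 - 2 * dist x (q i) / d))"
      using i by (intro member_le_sum) auto
    finally show ?thesis using True by (simp add: f_def)
  qed (simp add: f0)
  let ?X = "q ` {..<k}"
  define C where "C = (\<Union>x\<in>?X. cball x d)"
  have cl: "closed C" unfolding C_def by (intro closed_UN) auto
  have fX: "f x \<le> 1 - indicat_real (- C) x" for x
  proof (cases "x \<in> C")
    case False
    then have "d < dist x (q i)" if "i < k" for i
      using that by (force simp: C_def dist_commute)
    then have "max 0 (2 - 2 * dist x (q i) / d) = 0" if "i < k" for i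
      using that d by (simp add: field_simps)
    then have "f x = 0" by (simp add: f_def)
    then show ?thesis by (simp add: indicator_def)
  qed (simp add: f1)
  have int: "integrable Q f" if "prob_space Q" "sets Q = sets borel" for Q
  proof -
    interpret prob_space Q by fact
    have "f \<in> borel_measurable Q"
      using borel_measurable_continuous_onI[OF cont] that(2) by (simp cong: measurable_cong_sets)
    then show ?thesis
      using f0 f1 by (intro integrable_const_bound[of _ 1]) auto
  qed
  have "measure \<mu> (A k) = integral\<^sup>L \<mu> (indicat_real (A k))"
    using sets_eq_imp_space_eq[OF sets] by simp
  also have "\<dots> \<le> integral\<^sup>L \<mu> f"
    using fA by (intro integral_mono int \<mu>.prob_space_axioms sets) (auto simp: sets A_def \<mu>.emeasure_eq_measure)
  finally have "1 - e < integral\<^sup>L \<mu> f" using k e by simp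
  moreover have "(\<lambda>n. integral\<^sup>L (N n) f) \<longlonglongrightarrow> integral\<^sup>L \<mu> f"
    using conv \<open>f \<in> bcont\<close> by (simp add: weak_conv_seq_def)
  ultimately have "\<forall>\<^sub>F n in sequentially. 1 - e < integral\<^sup>L (N n) f"
    by (intro order_tendstoD)
  then have "\<forall>\<^sub>F n in sequentially. measure (N n) (- C) \<le> e"
  proof eventually_elim
    case (elim n)
    interpret Nn: prob_space "N n" using N by (simp add: prob_measures_def)
    have sN: "sets (N n) = sets borel" using N by (simp add: prob_measures_def)
    have "- C \<in> sets (N n)" using cl sN by simp
    then have iC: "integrable (N n) (indicat_real (- C))"
      by (intro integrable_real_indicator) (auto simp: Nn.emeasure_eq_measure)
    have "integral\<^sup>L (N n) f \<le> (\<integral>x. 1 - indicat_real (- C) x \<partial>N n)"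
      using iC by (intro integral_mono int Nn.prob_space_axioms sN fX) auto
    also have "\<dots> = 1 - measure (N n) (- C)"
      using iC Nn.prob_space sets_eq_imp_space_eq[OF sN] by (subst Bochner_Integration.integral_diff) auto
    finally show ?case using elim by simp
  qed
  then show ?thesis unfolding C_def by (intro exI[of _ ?X]) auto
qed

subsection \<open>Lower semicontinuity of the optimal transport cost\<close>

lemma couplingsD:
  assumes "\<pi> \<in> couplings \<mu> \<nu>"
  shows "prob_space \<pi>" "sets \<pi> = sets borel" "distr \<pi> borel fst = \<mu>" "distr \<pi> borel snd = \<nu>"
  using assms by (auto simp: couplings_def)

lemma measure_fst_coupling:
  assumes "\<pi> \<in> couplings \<mu> \<nu>" "A \<in> sets borel"
  shows "measure \<pi> (fst -` A) = measure \<mu> A"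
proof -
  have "fst \<in> measurable \<pi> borel"
    using borel_measurable_continuous_onI[of fst] couplingsD(2)[OF assms(1)]
    by (simp add: continuous_on_fst cong: measurable_cong_sets)
  then show ?thesis
    using measure_distr[of fst \<pi> borel A] couplingsD[OF assms(1)] assms(2)
      sets_eq_imp_space_eq[OF couplingsD(2)[OF assms(1)]] by simp
qed

lemma measure_snd_coupling:
  assumes "\<pi> \<in> couplings \<mu> \<nu>" "A \<in> sets borel"
  shows "measure \<pi> (snd -` A) = measure \<nu> A"
proof -
  have "snd \<in> measurable \<pi> borel"
    using borel_measurable_continuous_onI[of snd] couplingsD(2)[OF assms(1)]
    by (simp add: continuous_on_snd cong: measurable_cong_sets)
  then show ?thesis
    using measure_distr[of snd \<pi> borel A] couplingsD[OF assms(1)] assms(2)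
      sets_eq_imp_space_eq[OF couplingsD(2)[OF assms(1)]] by simp
qed

lemma mem_cball_Pair:
  assumes "a \<in> cball x (d / 2)" "b \<in> cball y (d / 2)"
  shows "(a, b) \<in> cball (x, y) d"
proof -
  have "dist (x, y) (a, b) \<le> dist x a + dist y b"
    unfolding dist_Pair_Pair by (intro sqrt_sum_squares_le_sum) auto
  then show ?thesis using assms by simp
qed

text \<open>A point outside all balls of radius \<open>d\<close> about X \<times> Y has a coordinate
  outside the balls of radius d/2 for its marginal. Its mass under a coupling is therefore
  controlled by the marginals, at most e/2 from each, and the bound survives the limit along
  \<open>G\<close>.\<close>

lemma couplings_cluster_tight:
  fixes \<mu> \<nu> :: "'a::{metric_space, second_countable_topology} measure"
  assumes conv: "weak_conv_seq N \<mu>" and N: "\<And>n. N n \<in> prob_measures"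
    and \<mu>: "\<mu> \<in> prob_measures" and \<nu>: "\<nu> \<in> prob_measures"
    and \<pi>: "\<And>n. \<pi> n \<in> couplings (N n) \<nu>"
    and G: "G \<noteq> bot" "G \<le> sequentially"
    and lim: "\<And>E. ((\<lambda>n. measure (\<pi> n) E) \<longlongrightarrow> L E) G"
    and e: "0 < e" and d: "0 < d"
  shows "\<exists>Z. finite Z \<and> L (- (\<Union>z\<in>Z. cball z d)) \<le> e"
proof -
  \<comment> \<open>The fixed marginal is treated as a constant sequence.\<close>
  have "weak_conv_seq (\<lambda>_::nat. \<nu>) \<nu>" by (simp add: weak_conv_seq_def)
  then obtain Y where Y: "finite Y" "measure \<nu> (- (\<Union>y\<in>Y. cball y (d / 2))) \<le> e / 2"
    using weak_conv_seq_tight[of "\<lambda>_. \<nu>" \<nu> "e / 2" "d / 2"] \<nu> e d by auto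
  obtain X where X: "finite X"
      "\<forall>\<^sub>F n in sequentially. measure (N n) (- (\<Union>x\<in>X. cball x (d / 2))) \<le> e / 2"
    using weak_conv_seq_tight[of N \<mu> "e / 2" "d / 2"] conv N \<mu> e d by auto
  let ?A = "- (\<Union>x\<in>X. cball x (d / 2))" and ?B = "- (\<Union>y\<in>Y. cball y (d / 2))"
  let ?C = "- (\<Union>z\<in>X \<times> Y. cball z d)"
  have opA: "open ?A" using X(1) by (intro open_Compl closed_UN) auto
  have opB: "open ?B" using Y(1) by (intro open_Compl closed_UN) auto
  have opC: "open ?C" using X(1) Y(1) by (intro open_Compl closed_UN) auto
  have C: "?C \<subseteq> fst -` ?A \<union> snd -` ?B"
  proof
    fix z assume z: "z \<in> ?C"
    show "z \<in> fst -` ?A \<union> snd -` ?B"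
    proof (rule ccontr)
      assume "z \<notin> fst -` ?A \<union> snd -` ?B"
      then obtain x y where "x \<in> X" "fst z \<in> cball x (d / 2)" "y \<in> Y" "snd z \<in> cball y (d / 2)"
        by blast
      then have "(x, y) \<in> X \<times> Y" "z \<in> cball (x, y) d"
        using mem_cball_Pair[of "fst z" x d "snd z" y] by auto
      with z show False by blast
    qed
  qed
  have "\<forall>\<^sub>F n in G. measure (\<pi> n) ?C \<le> e"
    using filter_leD[OF G(2) X(2)]
  proof eventually_elim
    case (elim n)
    interpret \<pi>: prob_space "\<pi> n" using couplingsD[OF \<pi>] by simp
    have sets: "sets (\<pi> n) = sets borel" using couplingsD[OF \<pi>] by simp
    have op: "open (fst -` ?A :: ('a \<times> 'a) set)" "open (snd -` ?B :: ('a \<times> 'a) set)"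
      using opA opB by (simp_all add: open_vimage_fst open_vimage_snd)
    have "measure (\<pi> n) ?C \<le> measure (\<pi> n) (fst -` ?A \<union> snd -` ?B)"
      using op by (intro \<pi>.finite_measure_mono C) (auto simp: sets)
    also have "\<dots> \<le> measure (\<pi> n) (fst -` ?A) + measure (\<pi> n) (snd -` ?B)"
      using op by (intro measure_Un_le) (auto simp: sets)
    also have "\<dots> = measure (N n) ?A + measure \<nu> ?B"
      using measure_fst_coupling[OF \<pi>[of n], of ?A] measure_snd_coupling[OF \<pi>[of n], of ?B] opA opB by simp
    also have "\<dots> \<le> e" using elim Y(2) by simp
    finally show ?case .
  qed
  then have "L ?C \<le> e"
    using lim G(1) by (intro tendsto_upperbound)
  then show ?thesis using X(1) Y(1) by (intro exI[of _ "X \<times> Y"]) auto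
qed

text \<open>The strict bound supplies couplings of cost below \<open>K\<close> without any attained
  infimum. Their limit measure \<open>P\<close> has the limit marginals and cost at most
  \<open>K\<close>, so it is a competitor for \<mu> and \<nu>.\<close>

lemma OT_cost_lower_semicontinuous:
  fixes c :: "'a::polish_space \<Rightarrow> 'a \<Rightarrow> ennreal"
  assumes c: "cost_function c"
    and conv: "weak_conv_seq N \<mu>" and N: "\<And>n. N n \<in> prob_measures"
    and \<mu>: "\<mu> \<in> prob_measures" and \<nu>: "\<nu> \<in> prob_measures"
    and K: "\<And>n. OT_cost c (N n) \<nu> < K"
  shows "OT_cost c \<mu> \<nu> \<le> K"
proof -
  have "\<exists>\<pi>\<in>couplings (N n) \<nu>. (\<integral>\<^sup>+p. c (fst p) (snd p) \<partial>\<pi>) < K" for n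
    using K[of n] unfolding OT_cost_def INF_less_iff .
  then obtain \<pi> where \<pi>: "\<And>n. \<pi> n \<in> couplings (N n) \<nu>"
      "\<And>n. (\<integral>\<^sup>+p. c (fst p) (snd p) \<partial>\<pi> n) < K"
    by metis
  have prob: "prob_space (\<pi> n)" and sets: "sets (\<pi> n) = sets borel" for n
    using couplingsD[OF \<pi>(1)] by auto
  obtain G L where G: "G \<noteq> bot" "G \<le> sequentially"
    and lim: "\<And>E. ((\<lambda>n. measure (\<pi> n) E) \<longlongrightarrow> L E) G"
    by (rule pointwise_cluster_filter[of "\<lambda>n E. measure (\<pi> n) E"])
      (auto simp: prob_space.prob_le_1 prob)
  interpret tight_content L
  proof
    show "0 \<le> L E" for E
      using G(1) by (intro tendsto_lowerbound[OF lim] always_eventually allI measure_nonneg)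
    show "L (E \<union> F) = L E + L F" if "E \<in> sets borel" "F \<in> sets borel" "E \<inter> F = {}" for E F
    proof (rule tendsto_unique[OF G(1) lim])
      have "measure (\<pi> n) (E \<union> F) = measure (\<pi> n) E + measure (\<pi> n) F" for n
        using that prob[of n]
        by (intro finite_measure.finite_measure_Union prob_space.finite_measure) (auto simp: sets)
      then show "((\<lambda>n. measure (\<pi> n) (E \<union> F)) \<longlongrightarrow> L E + L F) G"
        by (simp add: tendsto_add lim)
    qed
    have "measure (\<pi> n) UNIV = 1" for n
      using prob_space.prob_space[OF prob[of n]] sets_eq_imp_space_eq[OF sets[of n]] by simp
    then show "L UNIV = 1"
      using tendsto_unique[OF G(1) lim[of UNIV], of 1] by simp
    show "\<exists>X. finite X \<and> L (- (\<Union>x\<in>X. cball x d)) \<le> e" if "0 < e" "0 < d" for e d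
      using conv N \<mu> \<nu> \<pi>(1) G lim that by (rule couplings_cluster_tight)
  qed
  obtain P where P: "prob_space P" "sets P = sets borel" "\<And>U. open U \<Longrightarrow> measure P U \<le> L U"
    by (rule dominated_measure_exists) blast
  interpret open_dominated_cluster \<pi> P L G
    by (rule open_dominated_cluster.intro[OF prob sets P(1,2) G(1) lim P(3)])
  have "distr P borel fst = \<mu>"
  proof (rule distr_eq_weak_limit)
    show "weak_conv_seq (\<lambda>n. distr (\<pi> n) borel fst) \<mu>"
      using conv by (simp only: couplingsD(3)[OF \<pi>(1)])
  qed (use G(2) \<mu> in \<open>simp_all add: continuous_on_fst\<close>)
  moreover have "distr P borel snd = \<nu>"
  proof (rule distr_eq_weak_limit)
    show "weak_conv_seq (\<lambda>n. distr (\<pi> n) borel snd) \<nu>"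
      by (simp add: couplingsD(4)[OF \<pi>(1)] weak_conv_seq_def)
  qed (use G(2) \<nu> in \<open>simp_all add: continuous_on_snd\<close>)
  ultimately have "P \<in> couplings \<mu> \<nu>"
    using P by (simp add: couplings_def)
  then have "OT_cost c \<mu> \<nu> \<le> (\<integral>\<^sup>+p. c (fst p) (snd p) \<partial>P)"
    unfolding OT_cost_def by (rule INF_lower)
  also have "\<dots> \<le> K"
  proof (rule nn_integral_le)
    show "closed {p. c (fst p) (snd p) \<le> t}" for t
      using c by (simp add: cost_function_def)
    show "\<forall>\<^sub>F n in G. (\<integral>\<^sup>+p. c (fst p) (snd p) \<partial>\<pi> n) \<le> K"
      using \<pi>(2) by (intro always_eventually allI less_imp_le)
  qed
  finally show ?thesis .
qed

section \<open>Scaling of the transport cost\<close>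

lemma cost_function_measurable:
  assumes "cost_function c" "sets \<pi> = sets borel"
  shows "(\<lambda>p. c (fst p) (snd p)) \<in> borel_measurable \<pi>"
proof -
  have "open {p. t < c (fst p) (snd p)}" for t
    using assms(1) by (simp add: cost_function_def closed_def Collect_neg_eq[symmetric] not_le)
  then have "{p. t < c (fst p) (snd p)} \<in> sets \<pi>" for t
    using assms(2) by simp
  then show ?thesis
    using sets_eq_imp_space_eq[OF assms(2)] by (intro borel_measurableI_greater) auto
qed

lemma OT_cost_cmult_ge:
  assumes "cost_function c"
  shows "r * OT_cost c \<mu> \<nu> \<le> OT_cost (\<lambda>x y. r * c x y) \<mu> \<nu>"
  unfolding OT_cost_def
proof (rule INF_greatest)
  fix \<pi> assume \<pi>: "\<pi> \<in> couplings \<mu> \<nu>"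
  then have "r * (INF \<pi>\<in>couplings \<mu> \<nu>. \<integral>\<^sup>+p. c (fst p) (snd p) \<partial>\<pi>) \<le> r * (\<integral>\<^sup>+p. c (fst p) (snd p) \<partial>\<pi>)"
    by (intro mult_left_mono INF_lower) auto
  also have "\<dots> = (\<integral>\<^sup>+p. r * c (fst p) (snd p) \<partial>\<pi>)"
    using assms couplingsD(2)[OF \<pi>] by (intro nn_integral_cmult[symmetric] cost_function_measurable)
  finally show "r * (INF \<pi>\<in>couplings \<mu> \<nu>. \<integral>\<^sup>+p. c (fst p) (snd p) \<partial>\<pi>) \<le> (\<integral>\<^sup>+p. r * c (fst p) (snd p) \<partial>\<pi>)" .
qed

lemma ennreal_inverse_mult_cancel:
  assumes "0 < r"
  shows "ennreal (1 / r) * (ennreal r * x) = x" "ennreal r * (ennreal (1 / r) * x) = x"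
  using assms by (simp_all add: mult.assoc[symmetric] ennreal_mult[symmetric])

lemma ennreal_mult_le_iff_div:
  assumes "0 < r"
  shows "ennreal r * x \<le> y \<longleftrightarrow> x \<le> ennreal (1 / r) * y"
  using assms ennreal_inverse_mult_cancel[OF assms] by (metis mult_left_mono zero_le)

lemma cost_function_cmult:
  assumes "cost_function c" "0 < r"
  shows "cost_function (\<lambda>x y. ennreal r * c x y)"
  using assms by (simp add: cost_function_def ennreal_mult_le_iff_div)

text \<open>One inequality is \<open>OT_cost_cmult_ge\<close>. The other is the same inequality for
  the scaled cost and the factor 1/r.\<close>

lemma OT_cost_cmult:
  assumes "cost_function c" "0 < r"
  shows "OT_cost (\<lambda>x y. ennreal r * c x y) \<mu> \<nu> = ennreal r * OT_cost c \<mu> \<nu>"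
proof (rule antisym)
  have "ennreal (1 / r) * OT_cost (\<lambda>x y. ennreal r * c x y) \<mu> \<nu>
      \<le> OT_cost (\<lambda>x y. ennreal (1 / r) * (ennreal r * c x y)) \<mu> \<nu>"
    by (intro OT_cost_cmult_ge cost_function_cmult assms)
  also have "\<dots> = OT_cost c \<mu> \<nu>"
    using assms(2) by (simp add: ennreal_inverse_mult_cancel)
  finally have "ennreal r * (ennreal (1 / r) * OT_cost (\<lambda>x y. ennreal r * c x y) \<mu> \<nu>)
      \<le> ennreal r * OT_cost c \<mu> \<nu>"
    by (intro mult_left_mono) auto
  then show "OT_cost (\<lambda>x y. ennreal r * c x y) \<mu> \<nu> \<le> ennreal r * OT_cost c \<mu> \<nu>"
    using assms(2) by (simp only: ennreal_inverse_mult_cancel)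
qed (use assms(1) in \<open>rule OT_cost_cmult_ge\<close>)

section \<open>Comparison of the scaled infimal convolution with the transport cost\<close>

lemma D_cost_upper:
  assumes "pre_divergence D" "cost_function c" "\<mu> \<in> prob_measures" "0 < r"
  shows "ennreal (1 / r) * D_cost D (\<lambda>x y. ennreal r * c x y) \<nu> \<mu> \<le> OT_cost c \<mu> \<nu>"
proof -
  have "D_cost D (\<lambda>x y. ennreal r * c x y) \<nu> \<mu> \<le> D \<mu> \<mu> + OT_cost (\<lambda>x y. ennreal r * c x y) \<mu> \<nu>"
    unfolding D_cost_def using assms(3) by (rule INF_lower)
  also have "\<dots> = ennreal r * OT_cost c \<mu> \<nu>"
    using assms by (simp add: pre_divergence_def OT_cost_cmult)
  finally have "ennreal (1 / r) * D_cost D (\<lambda>x y. ennreal r * c x y) \<nu> \<mu>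
      \<le> ennreal (1 / r) * (ennreal r * OT_cost c \<mu> \<nu>)"
    by (intro mult_left_mono) auto
  then show ?thesis by (simp only: ennreal_inverse_mult_cancel[OF assms(4)])
qed

text \<open>Both summands are nonnegative, so a total below r K bounds each one, and
  \<open>r\<close> cancels from the transport term. \<open>K\<close> is a real number so that the
  bound r K on the divergence vanishes as \<open>r\<close> tends to 0.\<close>

lemma D_cost_near_minimizer:
  assumes "cost_function c" "0 < r"
    and "ennreal (1 / r) * D_cost D (\<lambda>x y. ennreal r * c x y) \<nu> \<mu> < ennreal K"
  obtains \<eta> where "\<eta> \<in> prob_measures" "D \<eta> \<mu> < ennreal (r * K)" "OT_cost c \<eta> \<nu> < ennreal K"
proof -
  have K: "ennreal (r * K) = ennreal r * ennreal K"
    using assms(2) by (simp add: ennreal_mult')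
  have scale: "ennreal r * x < ennreal r * ennreal K \<longleftrightarrow> x < ennreal K" for x
    using assms(2) ennreal_inverse_mult_cancel(1)[OF assms(2)]
    by (metis ennreal_mult_le_iff_div not_le)
  have "D_cost D (\<lambda>x y. ennreal r * c x y) \<nu> \<mu> < ennreal r * ennreal K"
    using assms(2,3) scale ennreal_inverse_mult_cancel(2)[OF assms(2)] by metis
  then obtain \<eta> where \<eta>: "\<eta> \<in> prob_measures"
      "D \<eta> \<mu> + OT_cost (\<lambda>x y. ennreal r * c x y) \<eta> \<nu> < ennreal r * ennreal K"
    unfolding D_cost_def INF_less_iff by blast
  then have "D \<eta> \<mu> + ennreal r * OT_cost c \<eta> \<nu> < ennreal r * ennreal K"
    by (simp only: OT_cost_cmult[OF assms(1,2)])
  then have "D \<eta> \<mu> < ennreal r * ennreal K" "ennreal r * OT_cost c \<eta> \<nu> < ennreal r * ennreal K"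
    by (meson le_add1 le_add_same_cancel1 add_increasing2 le_less_trans order_refl zero_le add_increasing)+
  then show ?thesis using that \<eta>(1) K scale by metis
qed

theorem theorem4:
  fixes D :: "('a::polish_space) measure \<Rightarrow> 'a measure \<Rightarrow> ennreal"
    and c :: "'a \<Rightarrow> 'a \<Rightarrow> ennreal"
    and \<mu> \<nu> :: "'a measure"
  assumes "pre_divergence D"
    and "cost_function c"
    and "\<mu> \<in> prob_measures"
    and "\<nu> \<in> prob_measures"
    and lsc: "\<forall>t::ennreal. closedin weak_topology {P \<in> prob_measures. D P \<mu> \<le> t}"
    and cpt: "\<forall>t::real. compactin weak_topology {P \<in> prob_measures. D P \<mu> \<le> ennreal t}"
    and "\<forall>Ps. (\<forall>n. Ps n \<in> prob_measures) \<and> (\<lambda>n. D (Ps n) \<mu>) \<longlonglongrightarrow> 0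
            \<longrightarrow> weak_conv_seq Ps \<mu>"
  shows "((\<lambda>r::real. ennreal (1 / r) * D_cost D (\<lambda>x y. ennreal r * c x y) \<nu> \<mu>)
           \<longlongrightarrow> OT_cost c \<mu> \<nu>) (at_right 0)"
    (is "(?v \<longlongrightarrow> _) _")
proof (rule order_tendstoI)
  fix a assume a: "OT_cost c \<mu> \<nu> < a"
  have "\<forall>\<^sub>F r::real in at_right 0. 0 < r"
    by (rule eventually_at_right_less)
  then show "\<forall>\<^sub>F r in at_right 0. ?v r < a"
  proof eventually_elim
    case (elim r)
    show ?case using D_cost_upper[OF assms(1,2,3) elim] a by (rule le_less_trans)
  qed
next
  fix a assume "a < OT_cost c \<mu> \<nu>"
  \<comment> \<open>An intermediate level turns the bound by \<open>a\<close> into a strict one, and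
    it is finite even if the transport cost is infinite.\<close>
  then obtain K' where K': "a < K'" "K' < OT_cost c \<mu> \<nu>" using dense by blast
  then obtain K where K: "K' = ennreal K" "0 \<le> K" by (cases K') auto
  show "\<forall>\<^sub>F r in at_right 0. a < ?v r"
  proof (rule ccontr)
    assume "\<not> (\<forall>\<^sub>F r in at_right 0. a < ?v r)"
    then have "\<exists>r>0. r < b \<and> ?v r \<le> a" if "0 < b" for b
      using that unfolding eventually_at_right_field by (force simp: not_less)
    then have "\<exists>r>0. r < 1 / real (Suc n) \<and> ?v r \<le> a" for n
      by simp
    then obtain r where r: "\<And>n. 0 < r n" "\<And>n. r n < 1 / real (Suc n)" "\<And>n. ?v (r n) \<le> a"
      by metis
    have "?v (r n) < ennreal K" for n
      using r(3)[of n] K'(1) K(1) by simp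
    then have "\<exists>\<eta>. \<eta> \<in> prob_measures \<and> D \<eta> \<mu> < ennreal (r n * K) \<and> OT_cost c \<eta> \<nu> < ennreal K" for n
      using D_cost_near_minimizer[OF assms(2) r(1)] by metis
    then obtain \<eta> where \<eta>: "\<And>n. \<eta> n \<in> prob_measures" "\<And>n. D (\<eta> n) \<mu> < ennreal (r n * K)"
        "\<And>n. OT_cost c (\<eta> n) \<nu> < ennreal K"
      by metis
    have "r \<longlonglongrightarrow> 0"
    proof (rule tendsto_sandwich[of "\<lambda>_. 0" r sequentially "\<lambda>n. 1 / real (Suc n)"])
      show "(\<lambda>n. 1 / real (Suc n)) \<longlonglongrightarrow> 0"
        by (rule LIMSEQ_Suc[OF lim_1_over_n])
      show "\<forall>\<^sub>F n in sequentially. r n \<le> 1 / real (Suc n)"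
        using r(2) by (intro always_eventually allI less_imp_le)
    qed (use r in \<open>auto intro!: always_eventually less_imp_le\<close>)
    then have "(\<lambda>n. r n * K) \<longlonglongrightarrow> 0"
      by (rule tendsto_mult_left_zero)
    then have "(\<lambda>n. ennreal (r n * K)) \<longlonglongrightarrow> 0"
      using tendsto_ennrealI[of _ 0] by simp
    \<comment> \<open>The divergences are squeezed between 0 and \<open>r n * K\<close>; this is
      what triggers the convergence hypothesis on \<open>D\<close>.\<close>
    then have "(\<lambda>n. D (\<eta> n) \<mu>) \<longlonglongrightarrow> 0"
      by (rule tendsto_sandwich[OF _ _ tendsto_const, rotated 2])
        (auto intro!: always_eventually less_imp_le \<eta>(2))
    then have "weak_conv_seq \<eta> \<mu>"
      using assms(7) \<eta>(1) by blast
    then have "OT_cost c \<mu> \<nu> \<le> ennreal K"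
      using assms(2,3,4) \<eta>(1,3) by (intro OT_cost_lower_semicontinuous)
    with K'(2) K(1) show False by simp
  qed
qed

end
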